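(* Let $\sigma_\xi>0$ and $\rho\in(-1,0)$, and let $(Y_t)_{t\ge1}$ be the gaussian convolution-based Markov process with parameters $\rho$ and $\sigma_\xi$ and innovations $(\xi_t)_{t\ge1}$ defined in the context. Then for every integer $k\ge1$ the $k$-th order autocorrelation function of $(\xi_t)_{t\ge1}$ satisfies $$\lim_{t\to+\infty}\operatorname{corr}(\xi_t,\xi_{t+k})=-\rho^2(1-2\rho^2)^{k-1}.$$
   Context: The gaussian convolution-based Markov process with parameters $\rho$ and $\sigma_\xi$ is a real-valued discrete-time Markov process $(Y_t)_{t\geq 0}$ satisfying $$Y_t=Y_{t-1}+\xi_t\quad(t\ge1),\qquad Y_0=0,$$ where the innovations $(\xi_t)_{t\ge1}$ are identically distributed, gaussian, with mean zero and standard deviation $\sigma_\xi$, and where, for every $t\ge2$, the copula of the pair $(Y_{t-1},\xi_t)$ is the bivariate gaussian copula with the same (time-invariant) correlation parameter $\rho$. In particular $Y_1=\xi_1$. The gaussian copula with parameter $\rho$ is the copula of a bivariate normal vector with standard normal margins and correlation $\rho$; the copula $C$ of a pair $(X,Z)$ is given by Sklar's theorem: $P(X\le x,Z\le z)=C(F_X(x),F_Z(z))$. The $k$-th order autocorrelation function of $(\xi_t)_{t\ge1}$ is $t\mapsto\operatorname{corr}(\xi_t,\xi_{t+k})$. For $k=1$ the factor $(1-2\rho^2)^{0}$ is $1$ (also when $1-2\rho^2=0$). *)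

theory Defs
  imports "HOL-Probability.Probability"
begin

section \<open>Covariance and correlation\<close>

definition covariance :: "'a measure \<Rightarrow> ('a \<Rightarrow> real) \<Rightarrow> ('a \<Rightarrow> real) \<Rightarrow> real" where
  "covariance M X Z =
     (\<integral>\<omega>. (X \<omega> - (\<integral>\<omega>'. X \<omega>' \<partial>M)) * (Z \<omega> - (\<integral>\<omega>'. Z \<omega>' \<partial>M)) \<partial>M)"

definition corr :: "'a measure \<Rightarrow> ('a \<Rightarrow> real) \<Rightarrow> ('a \<Rightarrow> real) \<Rightarrow> real" where
  "corr M X Z = covariance M X Z / (sqrt (covariance M X X) * sqrt (covariance M Z Z))"


section \<open>Copulas\<close>

text \<open>
  A bivariate copula is a grounded, 2-increasing function on the unit square with uniform
  margins. Only the values on the unit square matter; a copula is represented here by any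
  function on the plane whose restriction to the unit square is one.
\<close>

definition copula :: "(real \<Rightarrow> real \<Rightarrow> real) \<Rightarrow> bool" where
  "copula C \<longleftrightarrow>
     (\<forall>u\<in>{0..1}. C u 0 = 0 \<and> C 0 u = 0 \<and> C u 1 = u \<and> C 1 u = u) \<and>
     (\<forall>u\<in>{0..1}. \<forall>u'\<in>{0..1}. \<forall>v\<in>{0..1}. \<forall>v'\<in>{0..1}.
        u \<le> u' \<longrightarrow> v \<le> v' \<longrightarrow> 0 \<le> C u' v' - C u v' - C u' v + C u v)"

text \<open>
  Sklar's relation. It determines the copula uniquely on the unit square whenever both margins
  are continuous.
\<close>

definition copula_of :: "'a measure \<Rightarrow> ('a \<Rightarrow> real) \<Rightarrow> ('a \<Rightarrow> real) \<Rightarrow> (real \<Rightarrow> real \<Rightarrow> real) \<Rightarrow> bool" where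
  "copula_of M X Z C \<longleftrightarrow>
     copula C \<and>
     (\<forall>x z. measure M {\<omega> \<in> space M. X \<omega> \<le> x \<and> Z \<omega> \<le> z} =
            C (cdf (distr M borel X) x) (cdf (distr M borel Z) z))"

text \<open>
  The bivariate normal law with standard normal margins and correlation \<open>\<rho>\<close>, given by its
  density; this is meaningful for \<open>\<bar>\<rho>\<bar> < 1\<close> only.
\<close>

definition std_binormal_density :: "real \<Rightarrow> real \<times> real \<Rightarrow> real" where
  "std_binormal_density \<rho> = (\<lambda>(x, y).
     exp (- (x\<^sup>2 - 2 * \<rho> * x * y + y\<^sup>2) / (2 * (1 - \<rho>\<^sup>2))) / (2 * pi * sqrt (1 - \<rho>\<^sup>2)))"

definition std_binormal :: "real \<Rightarrow> (real \<times> real) measure" where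
  "std_binormal \<rho> = density lborel (\<lambda>p. ennreal (std_binormal_density \<rho> p))"

lemma std_binormal_density_factorization:
  assumes "\<bar>\<rho>\<bar> < 1"
  shows "std_binormal_density \<rho> (x, y) =
           normal_density 0 1 x * normal_density (\<rho> * x) (sqrt (1 - \<rho>\<^sup>2)) y"
proof -
  have pos: "0 < 1 - \<rho>\<^sup>2"
    using assms by (simp add: abs_square_less_1)
  have expo: "- (x\<^sup>2 - 2 * \<rho> * x * y + y\<^sup>2) / (2 * (1 - \<rho>\<^sup>2)) =
      - x\<^sup>2 / 2 + - (y - \<rho> * x)\<^sup>2 / (2 * (1 - \<rho>\<^sup>2))"
    using pos by (simp add: divide_simps) (simp add: power2_eq_square algebra_simps)
  have const: "2 * pi * sqrt (1 - \<rho>\<^sup>2) = sqrt (2 * pi) * sqrt (2 * pi * (1 - \<rho>\<^sup>2))"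
  proof -
    have "sqrt (2 * pi) * sqrt (2 * pi * (1 - \<rho>\<^sup>2)) = (sqrt (2 * pi) * sqrt (2 * pi)) * sqrt (1 - \<rho>\<^sup>2)"
      unfolding real_sqrt_mult[of "2 * pi" "1 - \<rho>\<^sup>2"] by (rule mult.assoc[symmetric])
    then show ?thesis by simp
  qed
  show ?thesis
    using pos unfolding std_binormal_density_def normal_density_def prod.case expo const exp_add
    by simp
qed

definition gaussian_copula :: "real \<Rightarrow> (real \<Rightarrow> real \<Rightarrow> real) \<Rightarrow> bool" where
  "gaussian_copula \<rho> C \<longleftrightarrow> copula_of (std_binormal \<rho>) fst snd C"


section \<open>Discrete-time Markov processes\<close>

definition generated_sigma :: "'a measure \<Rightarrow> (nat \<Rightarrow> 'a \<Rightarrow> real) \<Rightarrow> nat set \<Rightarrow> 'a measure" where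
  "generated_sigma M Y I = sigma (space M) {Y i -` A \<inter> space M | i A. i \<in> I \<and> A \<in> sets borel}"

lemma subalgebra_generated_sigma:
  assumes "\<And>i. i \<in> I \<Longrightarrow> Y i \<in> borel_measurable M"
  shows "subalgebra M (generated_sigma M Y I)"
  unfolding subalgebra_def generated_sigma_def
proof (intro conjI)
  have sub: "{Y i -` A \<inter> space M | i A. i \<in> I \<and> A \<in> sets borel} \<subseteq> sets M"
    using assms by (auto intro: measurable_sets)
  then have *: "{Y i -` A \<inter> space M | i A. i \<in> I \<and> A \<in> sets borel} \<subseteq> Pow (space M)"
    by blast
  show "space (sigma (space M) {Y i -` A \<inter> space M | i A. i \<in> I \<and> A \<in> sets borel}) = space M"
    using * by (rule space_measure_of)
  show "sets (sigma (space M) {Y i -` A \<inter> space M | i A. i \<in> I \<and> A \<in> sets borel}) \<subseteq> sets M"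
    using sub by (simp add: sets_measure_of[OF *] sets.sigma_sets_subset)
qed

text \<open>
  The Markov property with respect to the natural filtration: almost surely,
  \<open>P(Y\<^sub>t\<^sub>+\<^sub>1 \<in> A | Y\<^sub>0, \<dots>, Y\<^sub>t) = P(Y\<^sub>t\<^sub>+\<^sub>1 \<in> A | Y\<^sub>t)\<close>.
\<close>

locale real_markov_process = prob_space M for M :: "'a measure" +
  fixes Y :: "nat \<Rightarrow> 'a \<Rightarrow> real"
  assumes measurable_Y: "\<And>t. Y t \<in> borel_measurable M"
    and markov: "\<And>t A. A \<in> sets borel \<Longrightarrow>
      AE \<omega> in M.
        real_cond_exp M (generated_sigma M Y {..t}) (indicat_real (Y (Suc t) -` A \<inter> space M)) \<omega> =
        real_cond_exp M (generated_sigma M Y {t}) (indicat_real (Y (Suc t) -` A \<inter> space M)) \<omega>"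


section \<open>The gaussian convolution-based Markov process\<close>

text \<open>The value \<open>\<xi> 0\<close> is junk: the innovations are indexed from 1.\<close>

locale gaussian_convolution_markov_process = real_markov_process M Y
  for M :: "'a measure" and Y :: "nat \<Rightarrow> 'a \<Rightarrow> real" +
  fixes \<xi> :: "nat \<Rightarrow> 'a \<Rightarrow> real" and \<rho> \<sigma> :: real
  assumes Y_0: "\<And>\<omega>. \<omega> \<in> space M \<Longrightarrow> Y 0 \<omega> = 0"
    and Y_step: "\<And>t \<omega>. 1 \<le> t \<Longrightarrow> \<omega> \<in> space M \<Longrightarrow> Y t \<omega> = Y (t - 1) \<omega> + \<xi> t \<omega>"
    and innovation_normal: "\<And>t. 1 \<le> t \<Longrightarrow> distributed M lborel (\<xi> t) (normal_density 0 \<sigma>)"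
    and innovation_copula: "\<exists>C. gaussian_copula \<rho> C \<and> (\<forall>t\<ge>2. copula_of M (Y (t - 1)) (\<xi> t) C)"

end

theory Submission
  imports Defs
begin

text \<open>
  Write \<open>v\<^sub>t\<close> for the standard deviation of \<open>Y\<^sub>t\<close> and \<open>F\<^sub>t\<close> for the past up to time \<open>t\<close>. Two facts carry the
  proof.

  The gaussian copula together with normal margins forces \<open>(Y\<^sub>t, \<xi>\<^sub>t\<^sub>+\<^sub>1)\<close> to be bivariate normal
  (\<open>gaussian_copula_joint_law\<close>), hence \<open>\<xi>\<^sub>t\<^sub>+\<^sub>1 = (\<rho>\<sigma> / v\<^sub>t) Y\<^sub>t + \<sigma> \<surd>(1 - \<rho>\<^sup>2) W\<close> with a standard normal
  \<open>W\<close> independent of \<open>Y\<^sub>t\<close> (\<open>gaussian_copula_regression\<close>). Inductively, every \<open>Y\<^sub>t\<close> with \<open>t \<ge> 1\<close> is normal, and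
  \<open>v\<^sub>t\<^sub>+\<^sub>1\<^sup>2 = v\<^sub>t\<^sup>2 + 2\<rho>\<sigma>v\<^sub>t + \<sigma>\<^sup>2\<close>. For negative \<open>\<rho>\<close> this recursion has the positive fixed point
  \<open>-\<sigma> / (2\<rho>)\<close>, and it contracts towards it (\<open>walk_sd_tendsto\<close>).

  The copula says nothing about times before \<open>t\<close>; there the Markov property enters: the past influences the mean of
  \<open>Y\<^sub>t\<^sub>+\<^sub>1\<close> only through \<open>Y\<^sub>t\<close> (\<open>markov_cond_exp\<close>), so \<open>E(Y\<^sub>t\<^sub>+\<^sub>1 | F\<^sub>t) = (1 + \<rho>\<sigma> / v\<^sub>t) Y\<^sub>t\<close>
  (\<open>cond_exp_next\<close>). Iterating this,
  \<open>E(\<xi>\<^sub>t \<xi>\<^sub>t\<^sub>+\<^sub>k) = (\<rho>\<sigma> / v\<^bsub>t+k-1\<^esub>) \<Prod>\<^bsub>t \<le> i < t+k-1\<^esub> (1 + \<rho>\<sigma> / v\<^sub>i) E(\<xi>\<^sub>t Y\<^sub>t)\<close> with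
  \<open>E(\<xi>\<^sub>t Y\<^sub>t) = \<sigma>\<^sup>2 + \<rho>\<sigma>v\<^bsub>t-1\<^esub>\<close>. As \<open>t\<close> grows, \<open>\<rho>\<sigma> / v\<^sub>t\<close> tends to \<open>-2\<rho>\<^sup>2\<close> and \<open>E(\<xi>\<^sub>t Y\<^sub>t)\<close> to
  \<open>\<sigma>\<^sup>2 / 2\<close>; after division by \<open>\<sigma>\<^sup>2\<close> the product tends to \<open>-\<rho>\<^sup>2 (1 - 2\<rho>\<^sup>2)\<^bsup>k-1\<^esup>\<close>.
\<close>

section \<open>The gaussian copula and linear regression\<close>

definition std_gauss :: "real measure" where
  "std_gauss = density lborel (\<lambda>x. ennreal (std_normal_density x))"

lemma prob_space_std_gauss: "prob_space std_gauss"
  unfolding std_gauss_def by (rule prob_space_normal_density) simp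

lemma sets_std_gauss [simp, measurable_cong]: "sets std_gauss = sets borel"
  by (simp add: std_gauss_def)

lemma space_std_gauss [simp]: "space std_gauss = UNIV"
  by (simp add: std_gauss_def)

lemma distributed_std_normal_iff:
  "distributed M lborel X std_normal_density \<longleftrightarrow> X \<in> borel_measurable M \<and> distr M borel X = std_gauss"
proof -
  have "distr M lborel X = distr M borel X"
    by (rule distr_cong) auto
  then show ?thesis
    by (auto simp: distributed_def std_gauss_def)
qed

lemma borel_measurable_std_binormal_density [measurable]:
  "std_binormal_density \<rho> \<in> borel_measurable borel"
  unfolding std_binormal_density_def borel_prod[symmetric] by measurable

lemma sets_std_binormal [simp, measurable_cong]: "sets (std_binormal \<rho>) = sets borel"
  by (simp add: std_binormal_def)

lemma space_std_binormal [simp]: "space (std_binormal \<rho>) = UNIV"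
  by (simp add: std_binormal_def)

text \<open>
  Regressing the second coordinate on the first splits the bivariate normal law: the density
  factors as \<open>\<phi>(x)\<close> times the normal density of \<open>z\<close> with mean \<open>\<rho> x\<close>, so the standardised residual
  \<open>(z - \<rho> x) / \<surd>(1 - \<rho>\<^sup>2)\<close> is standard normal whatever \<open>x\<close> is. Every later fact about gaussian
  pairs is reduced to an independent pair by this lemma.
\<close>

lemma std_binormal_residual:
  assumes "\<bar>\<rho>\<bar> < 1"
  shows "distr (std_binormal \<rho>) (borel \<Otimes>\<^sub>M borel) (\<lambda>p. (fst p, (snd p - \<rho> * fst p) / sqrt (1 - \<rho>\<^sup>2)))
         = std_gauss \<Otimes>\<^sub>M std_gauss" (is "distr _ _ ?T = _")
proof (rule measure_eqI)
  define s where "s = sqrt (1 - \<rho>\<^sup>2)"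
  have s: "0 < s"
    using assms by (simp add: s_def abs_square_less_1)
  show "sets (distr (std_binormal \<rho>) (borel \<Otimes>\<^sub>M borel) ?T) = sets (std_gauss \<Otimes>\<^sub>M std_gauss)"
    by (simp cong: sets_pair_measure_cong)
  fix A assume "A \<in> sets (distr (std_binormal \<rho>) (borel \<Otimes>\<^sub>M borel) ?T)"
  then have A [measurable]: "A \<in> sets (borel \<Otimes>\<^sub>M borel)" by simp
  have T [measurable]: "?T \<in> borel \<rightarrow>\<^sub>M borel \<Otimes>\<^sub>M borel"
    unfolding borel_prod[symmetric] by measurable
  have fubini: "(\<integral>\<^sup>+x. \<integral>\<^sup>+y. f (x, y) \<partial>lborel \<partial>lborel) = (\<integral>\<^sup>+p. f p \<partial>lborel)"
    if "f \<in> borel_measurable (lborel \<Otimes>\<^sub>M lborel)" for f :: "real \<times> real \<Rightarrow> ennreal"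
    using lborel.nn_integral_fst[OF that] by (simp add: lborel_prod)
  have "emeasure (distr (std_binormal \<rho>) (borel \<Otimes>\<^sub>M borel) ?T) A
      = emeasure (std_binormal \<rho>) (?T -` A \<inter> space (std_binormal \<rho>))"
    by (subst emeasure_distr) (auto simp: A)
  also have "\<dots> = (\<integral>\<^sup>+p. ennreal (std_binormal_density \<rho> p) * indicator A (?T p) \<partial>lborel)"
    unfolding std_binormal_def
    by (subst emeasure_density) (auto intro!: nn_integral_cong measurable_sets_borel[OF _ A] simp: indicator_def borel_prod)
  also have "\<dots> = (\<integral>\<^sup>+x. \<integral>\<^sup>+z. ennreal (std_binormal_density \<rho> (x, z)) * indicator A (x, (z - \<rho> * x) / s) \<partial>lborel \<partial>lborel)"
    by (subst fubini[symmetric]) (auto simp: s_def lborel_prod)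
  also have "\<dots> = (\<integral>\<^sup>+x. \<integral>\<^sup>+w. ennreal (std_normal_density x) * ennreal (std_normal_density w) * indicator A (x, w) \<partial>lborel \<partial>lborel)"
  proof (rule nn_integral_cong)
    fix x
    have nd: "s * normal_density (\<rho> * x) s (\<rho> * x + s * w) = std_normal_density w" for w
      using s by (simp add: normal_density_def real_sqrt_mult field_simps power2_eq_square)
    \<comment> \<open>the substitution \<open>z = \<rho> x + s w\<close> in the inner integral; its Jacobian \<open>s\<close> turns the conditional density into \<open>\<phi>(w)\<close>\<close>
    have "(\<integral>\<^sup>+z. ennreal (std_binormal_density \<rho> (x, z)) * indicator A (x, (z - \<rho> * x) / s) \<partial>lborel)
      = ennreal s * (\<integral>\<^sup>+w. ennreal (std_binormal_density \<rho> (x, \<rho> * x + s * w)) * indicator A (x, w) \<partial>lborel)"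
      using s by (subst nn_integral_real_affine[where c = s and t = "\<rho> * x"]) auto
    also have "\<dots> = (\<integral>\<^sup>+w. ennreal s * (ennreal (std_binormal_density \<rho> (x, \<rho> * x + s * w)) * indicator A (x, w)) \<partial>lborel)"
      by (subst nn_integral_cmult) auto
    also have "\<dots> = (\<integral>\<^sup>+w. ennreal (std_normal_density x) * ennreal (std_normal_density w) * indicator A (x, w) \<partial>lborel)"
    proof (intro nn_integral_cong)
      fix w
      have "s * std_binormal_density \<rho> (x, \<rho> * x + s * w) = std_normal_density x * std_normal_density w"
        using nd[of w] by (simp add: std_binormal_density_factorization[OF assms] s_def mult_ac)
      then show "ennreal s * (ennreal (std_binormal_density \<rho> (x, \<rho> * x + s * w)) * indicator A (x, w))
        = ennreal (std_normal_density x) * ennreal (std_normal_density w) * indicator A (x, w)"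
        using s by (simp add: mult.assoc[symmetric] ennreal_mult'[symmetric] ennreal_mult''[symmetric])
    qed
    finally show "(\<integral>\<^sup>+z. ennreal (std_binormal_density \<rho> (x, z)) * indicator A (x, (z - \<rho> * x) / s) \<partial>lborel)
      = (\<integral>\<^sup>+w. ennreal (std_normal_density x) * ennreal (std_normal_density w) * indicator A (x, w) \<partial>lborel)" .
  qed
  also have "\<dots> = emeasure (std_gauss \<Otimes>\<^sub>M std_gauss) A"
  proof -
    have "std_gauss \<Otimes>\<^sub>M std_gauss = density (lborel \<Otimes>\<^sub>M lborel)
        (\<lambda>(x, y). ennreal (std_normal_density x) * ennreal (std_normal_density y))"
      unfolding std_gauss_def
      by (rule pair_measure_density)
         (auto intro!: prob_space_imp_sigma_finite prob_space_normal_density lborel.sigma_finite_measure_axioms)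
    then show ?thesis
      using A by (simp add: emeasure_density lborel.nn_integral_fst[symmetric])
  qed
  finally show "emeasure (distr (std_binormal \<rho>) (borel \<Otimes>\<^sub>M borel) ?T) A
      = emeasure (std_gauss \<Otimes>\<^sub>M std_gauss) A" .
qed

text \<open>
  The total mass is not computed from the density: the image measure is a product of probability
  measures, and taking images preserves the total mass.
\<close>

lemma prob_space_std_binormal:
  assumes "\<bar>\<rho>\<bar> < 1"
  shows "prob_space (std_binormal \<rho>)"
proof -
  interpret G: prob_space std_gauss by (rule prob_space_std_gauss)
  interpret GG: pair_prob_space std_gauss std_gauss ..
  have T: "(\<lambda>p. (fst p, (snd p - \<rho> * fst p) / sqrt (1 - \<rho>\<^sup>2))) \<in> std_binormal \<rho> \<rightarrow>\<^sub>M (borel \<Otimes>\<^sub>M borel)"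
    unfolding measurable_cong_sets[OF sets_std_binormal refl] borel_prod[symmetric] by measurable
  have "prob_space (distr (std_binormal \<rho>) (borel \<Otimes>\<^sub>M borel)
      (\<lambda>p. (fst p, (snd p - \<rho> * fst p) / sqrt (1 - \<rho>\<^sup>2))))"
    unfolding std_binormal_residual[OF assms] by (rule GG.prob_space_axioms)
  then show ?thesis
    by (rule prob_space_distrD[OF T])
qed

lemma (in prob_space) binormal_residual_indep:
  assumes "\<bar>\<rho>\<bar> < 1"
    and [measurable]: "random_variable borel U" "random_variable borel Z"
    and law: "distr M borel (\<lambda>\<omega>. (U \<omega>, Z \<omega>)) = std_binormal \<rho>"
  defines "W \<equiv> (\<lambda>\<omega>. (Z \<omega> - \<rho> * U \<omega>) / sqrt (1 - \<rho>\<^sup>2))"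
  shows "indep_var borel U borel W"
    and "distributed M lborel U std_normal_density"
    and "distributed M lborel W std_normal_density"
proof -
  interpret G: prob_space std_gauss by (rule prob_space_std_gauss)
  have [measurable]: "random_variable borel W"
    unfolding W_def by measurable
  let ?T = "\<lambda>p. (fst p, (snd p - \<rho> * fst p) / sqrt (1 - \<rho>\<^sup>2)) :: real \<times> real"
  have T: "?T \<in> borel \<rightarrow>\<^sub>M borel \<Otimes>\<^sub>M borel"
    unfolding borel_prod[symmetric] by measurable
  have UZ: "(\<lambda>\<omega>. (U \<omega>, Z \<omega>)) \<in> M \<rightarrow>\<^sub>M borel"
    unfolding borel_prod[symmetric] by measurable
  have "distr M (borel \<Otimes>\<^sub>M borel) (\<lambda>\<omega>. (U \<omega>, W \<omega>))
      = distr (distr M borel (\<lambda>\<omega>. (U \<omega>, Z \<omega>))) (borel \<Otimes>\<^sub>M borel) ?T"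
    by (subst distr_distr[OF T UZ]) (simp add: comp_def W_def)
  also have "\<dots> = std_gauss \<Otimes>\<^sub>M std_gauss"
    unfolding law by (rule std_binormal_residual) fact
  finally have joint: "distr M (borel \<Otimes>\<^sub>M borel) (\<lambda>\<omega>. (U \<omega>, W \<omega>)) = std_gauss \<Otimes>\<^sub>M std_gauss" .
  have U: "distr M borel U = std_gauss"
  proof -
    have "distr M borel U = distr (distr M (borel \<Otimes>\<^sub>M borel) (\<lambda>\<omega>. (U \<omega>, W \<omega>))) borel fst"
      by (subst distr_distr) (simp_all add: comp_def)
    also have "\<dots> = distr (std_gauss \<Otimes>\<^sub>M std_gauss) std_gauss fst"
      unfolding joint by (rule distr_cong) auto
    finally show ?thesis by (simp add: G.distr_pair_fst)
  qed
  have W: "distr M borel W = std_gauss"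
  proof -
    have "distr M borel W = distr (distr M (borel \<Otimes>\<^sub>M borel) (\<lambda>\<omega>. (U \<omega>, W \<omega>))) borel snd"
      by (subst distr_distr) (simp_all add: comp_def)
    also have "\<dots> = distr (std_gauss \<Otimes>\<^sub>M std_gauss) borel snd"
      unfolding joint ..
    also have "\<dots> = std_gauss"
    proof (rule measure_eqI)
      fix A assume "A \<in> sets (distr (std_gauss \<Otimes>\<^sub>M std_gauss) borel snd)"
      then have A [measurable]: "A \<in> sets borel" by simp
      have "snd -` A \<inter> space (std_gauss \<Otimes>\<^sub>M std_gauss) = UNIV \<times> A"
        by (auto simp: space_pair_measure)
      then show "emeasure (distr (std_gauss \<Otimes>\<^sub>M std_gauss) borel snd) A = emeasure std_gauss A"
        using G.emeasure_space_1 by (simp add: emeasure_distr G.emeasure_pair_measure_Times)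
    qed simp
    finally show ?thesis .
  qed
  show "indep_var borel U borel W"
    unfolding indep_var_distribution_eq using joint U W by simp
  show "distributed M lborel U std_normal_density" "distributed M lborel W std_normal_density"
    using U W by (simp_all add: distributed_std_normal_iff)
qed

text \<open>
  The degenerate coefficient \<open>a = 0\<close> occurs in the application: when the standard deviation of \<open>Y\<^sub>t\<close>
  equals \<open>-\<rho>\<sigma>\<close>, the next position has no component along \<open>Y\<^sub>t\<close>.
\<close>

lemma (in prob_space) normal_linear_combination:
  assumes ind: "indep_var borel U borel W"
    and U: "distributed M lborel U std_normal_density"
    and W: "distributed M lborel W std_normal_density"
    and "b \<noteq> 0"
  shows "distributed M lborel (\<lambda>\<omega>. a * U \<omega> + b * W \<omega>) (normal_density 0 (sqrt (a\<^sup>2 + b\<^sup>2)))"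
proof -
  have bW: "distributed M lborel (\<lambda>\<omega>. b * W \<omega>) (normal_density 0 \<bar>b\<bar>)"
    using normal_density_affine[OF W, of b 0] \<open>b \<noteq> 0\<close> by simp
  show ?thesis
  proof (cases "a = 0")
    case True
    with bW show ?thesis by simp
  next
    case False
    have aU: "distributed M lborel (\<lambda>\<omega>. a * U \<omega>) (normal_density 0 \<bar>a\<bar>)"
      using normal_density_affine[OF U, of a 0] False by simp
    have "indep_var borel (\<lambda>\<omega>. a * U \<omega>) borel (\<lambda>\<omega>. b * W \<omega>)"
      using indep_var_compose[OF ind, of "\<lambda>x. a * x" borel "\<lambda>x. b * x" borel] by (simp add: comp_def)
    from add_indep_normal[OF this _ _ aU bW] show ?thesis
      using False \<open>b \<noteq> 0\<close> by simp
  qed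
qed

lemma std_binormal_margins:
  assumes "\<bar>\<rho>\<bar> < 1"
  shows "distr (std_binormal \<rho>) borel fst = std_gauss" "distr (std_binormal \<rho>) borel snd = std_gauss"
proof -
  interpret prob_space "std_binormal \<rho>" by (rule prob_space_std_binormal) fact
  define s where "s = sqrt (1 - \<rho>\<^sup>2)"
  have s: "0 < s" "s\<^sup>2 = 1 - \<rho>\<^sup>2"
    using assms by (simp_all add: s_def abs_square_less_1 abs_square_le_1)
  have [measurable]: "random_variable borel fst" "random_variable borel snd"
    unfolding measurable_cong_sets[OF sets_std_binormal refl] borel_prod[symmetric] by measurable
  have law: "distr (std_binormal \<rho>) borel (\<lambda>p. (fst p, snd p)) = std_binormal \<rho>"
    by (simp add: distr_id2)
  note * = binormal_residual_indep[OF assms _ _ law, folded s_def]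
  show "distr (std_binormal \<rho>) borel fst = std_gauss"
    using *(2) by (simp add: distributed_std_normal_iff)
  have "(\<lambda>p. \<rho> * fst p + s * ((snd p - \<rho> * fst p) / s)) = snd"
    using s by (auto simp: field_simps)
  then show "distr (std_binormal \<rho>) borel snd = std_gauss"
    using normal_linear_combination[OF *, of s \<rho>] s by (simp add: distributed_std_normal_iff)
qed

text \<open>
  The lower orthants are stable under intersection and generate the Borel sets, so a law on
  Euclidean space is determined by its joint distribution function.
\<close>

lemma prob_measure_eqI_atMost:
  fixes N1 N2 :: "'a::ordered_euclidean_space measure"
  assumes "prob_space N1" "prob_space N2" "sets N1 = sets borel" "sets N2 = sets borel"
    and eq: "\<And>a. measure N1 {..a} = measure N2 {..a}"
  shows "N1 = N2"
proof -
  interpret N1: prob_space N1 by fact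
  interpret N2: prob_space N2 by fact
  let ?E = "range (\<lambda>a::'a. {..a})"
  show ?thesis
  proof (rule measure_eqI_generator_eq[where \<Omega> = UNIV and E = ?E and A = "\<lambda>n. {..real n *\<^sub>R One}"])
    have "{..a} \<inter> {..b} = {..inf a b}" for a b :: 'a
      by auto
    then show "Int_stable ?E"
      unfolding Int_stable_def by auto
    show "sets N1 = sigma_sets UNIV ?E" "sets N2 = sigma_sets UNIV ?E"
      unfolding assms borel_eq_atMost by simp_all
    show "emeasure N1 X = emeasure N2 X" if "X \<in> ?E" for X
      using that eq by (auto simp: N1.emeasure_eq_measure N2.emeasure_eq_measure)
    show "(\<Union>n. {..real n *\<^sub>R One}) = (UNIV :: 'a set)"
    proof (rule UNIV_eq_I[symmetric])
      fix x :: 'a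
      obtain n where n: "Max ((\<lambda>i. x \<bullet> i) ` Basis) \<le> real n"
        using real_arch_simple by blast
      then have "x \<bullet> i \<le> real n" if "i \<in> Basis" for i
        using that by (subst (asm) Max_le_iff) auto
      then show "x \<in> (\<Union>n. {..real n *\<^sub>R One})"
        by (auto simp: eucl_le[where 'a='a])
    qed
  qed auto
qed

text \<open>
  Sklar's relation expresses the joint distribution function through the margins and the copula.
  Normal margins agree, up to scaling, with the margins of the bivariate normal law that defines the
  gaussian copula, so the two joint distribution functions coincide.
\<close>

lemma (in prob_space) gaussian_copula_joint_law:
  assumes "\<bar>\<rho>\<bar> < 1" "gaussian_copula \<rho> C" "copula_of M X Z C" "0 < a" "0 < b"
    and X: "distributed M lborel X (normal_density 0 a)"
    and Z: "distributed M lborel Z (normal_density 0 b)"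
  shows "distr M borel (\<lambda>\<omega>. (X \<omega> / a, Z \<omega> / b)) = std_binormal \<rho>"
proof -
  have rv [measurable]: "random_variable borel X" "random_variable borel Z"
    using distributed_measurable[OF X] distributed_measurable[OF Z] by simp_all
  have XZ: "(\<lambda>\<omega>. (X \<omega> / a, Z \<omega> / b)) \<in> M \<rightarrow>\<^sub>M borel"
    unfolding borel_prod[symmetric] by measurable
  have cdf_scale: "cdf (distr M borel V) (c * x) = cdf std_gauss x"
    if "0 < c" "distributed M lborel V (normal_density 0 c)" for V c x
  proof -
    have std: "distr M borel (\<lambda>\<omega>. V \<omega> / c) = std_gauss"
      using that normal_standard_normal_convert[of c V 0] by (simp add: distributed_std_normal_iff)
    have [measurable]: "random_variable borel V"
      using distributed_measurable[OF that(2)] by simp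
    have "cdf (distr M borel V) (c * x) = cdf (distr M borel (\<lambda>\<omega>. V \<omega> / c)) x"
      using that(1) unfolding cdf_def
      by (simp add: measure_distr vimage_def) (simp add: field_simps)
    then show ?thesis by (simp add: std)
  qed
  show ?thesis
  proof (rule prob_measure_eqI_atMost)
    show "prob_space (distr M borel (\<lambda>\<omega>. (X \<omega> / a, Z \<omega> / b)))"
      using XZ by (rule prob_space_distr)
    show "prob_space (std_binormal \<rho>)"
      by (rule prob_space_std_binormal) fact
    fix p :: "real \<times> real"
    obtain x z where p: "p = (x, z)" by (cases p)
    have "measure (distr M borel (\<lambda>\<omega>. (X \<omega> / a, Z \<omega> / b))) {..p}
        = measure M {\<omega> \<in> space M. X \<omega> \<le> a * x \<and> Z \<omega> \<le> b * z}"
      using XZ \<open>0 < a\<close> \<open>0 < b\<close> unfolding p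
      by (subst measure_distr) (auto intro!: arg_cong[where f = "measure M"] simp: field_simps less_eq_prod_def)
    also have "\<dots> = C (cdf std_gauss x) (cdf std_gauss z)"
      using assms by (simp add: copula_of_def cdf_scale)
    also have "\<dots> = measure (std_binormal \<rho>) {q \<in> space (std_binormal \<rho>). fst q \<le> x \<and> snd q \<le> z}"
      using \<open>gaussian_copula \<rho> C\<close>
      by (simp add: gaussian_copula_def copula_of_def std_binormal_margins[OF \<open>\<bar>\<rho>\<bar> < 1\<close>])
    also have "{q \<in> space (std_binormal \<rho>). fst q \<le> x \<and> snd q \<le> z} = {..p}"
      by (auto simp: p less_eq_prod_def)
    finally show "measure (distr M borel (\<lambda>\<omega>. (X \<omega> / a, Z \<omega> / b))) {..p} = measure (std_binormal \<rho>) {..p}" .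
  qed simp_all
qed

text \<open>
  The form in which the copula hypothesis is used: the second variable is a multiple of the first
  plus independent noise. The noise \<open>W\<close> yields the conditional mean of \<open>Z\<close>, and the same
  decomposition shows that \<open>X + Z\<close> is again normal.
\<close>

lemma (in prob_space) gaussian_copula_regression:
  assumes "\<bar>\<rho>\<bar> < 1" "gaussian_copula \<rho> C" "copula_of M X Z C" "0 < a" "0 < b"
    and X: "distributed M lborel X (normal_density 0 a)"
    and Z: "distributed M lborel Z (normal_density 0 b)"
  obtains W where "indep_var borel X borel W" "distributed M lborel W std_normal_density"
    "\<And>\<omega>. Z \<omega> = b * \<rho> / a * X \<omega> + b * sqrt (1 - \<rho>\<^sup>2) * W \<omega>"
    "distributed M lborel (\<lambda>\<omega>. X \<omega> + Z \<omega>) (normal_density 0 (sqrt (a\<^sup>2 + 2 * \<rho> * b * a + b\<^sup>2)))"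
proof -
  define s where "s = sqrt (1 - \<rho>\<^sup>2)"
  have s: "0 < s" "s\<^sup>2 = 1 - \<rho>\<^sup>2"
    using assms by (simp_all add: s_def abs_square_less_1 abs_square_le_1)
  have [measurable]: "random_variable borel X" "random_variable borel Z"
    using distributed_measurable[OF X] distributed_measurable[OF Z] by simp_all
  define W where "W = (\<lambda>\<omega>. (Z \<omega> / b - \<rho> * (X \<omega> / a)) / s)"
  note * = binormal_residual_indep[OF \<open>\<bar>\<rho>\<bar> < 1\<close> _ _ gaussian_copula_joint_law[OF assms], folded s_def, folded W_def]
  have UW: "indep_var borel (\<lambda>\<omega>. X \<omega> / a) borel W"
      "distributed M lborel (\<lambda>\<omega>. X \<omega> / a) std_normal_density" "distributed M lborel W std_normal_density"
    using * by simp_all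
  have eq: "Z \<omega> = b * \<rho> / a * X \<omega> + b * s * W \<omega>" for \<omega>
    using s assms(4,5) by (simp add: W_def field_simps)
  have ind: "indep_var borel X borel W"
  proof -
    have "indep_var borel ((\<lambda>x. a * x) \<circ> (\<lambda>\<omega>. X \<omega> / a)) borel ((\<lambda>x. x) \<circ> W)"
      by (rule indep_var_compose[OF UW(1)]) auto
    moreover have "(\<lambda>x. a * x) \<circ> (\<lambda>\<omega>. X \<omega> / a) = X" "(\<lambda>x. x) \<circ> W = W"
      using \<open>0 < a\<close> by auto
    ultimately show ?thesis by simp
  qed
  have "(\<lambda>\<omega>. (a + b * \<rho>) * (X \<omega> / a) + (b * s) * W \<omega>) = (\<lambda>\<omega>. X \<omega> + Z \<omega>)"
    using \<open>0 < a\<close> by (intro ext) (simp add: eq distrib_right add_divide_distrib)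
  moreover have "(a + b * \<rho>)\<^sup>2 + (b * s)\<^sup>2 = a\<^sup>2 + 2 * \<rho> * b * a + b\<^sup>2"
    by (simp add: power_mult_distrib s) (simp add: power2_eq_square algebra_simps)
  ultimately have "distributed M lborel (\<lambda>\<omega>. X \<omega> + Z \<omega>) (normal_density 0 (sqrt (a\<^sup>2 + 2 * \<rho> * b * a + b\<^sup>2)))"
    using normal_linear_combination[OF UW, of "b * s" "a + b * \<rho>"] s \<open>0 < b\<close> by simp
  with UW(3) ind eq show ?thesis
    using that by (simp add: s_def)
qed

section \<open>Conditional means in a Markov process\<close>

text \<open>
  Independence concerns the events \<open>Y\<^sub>t \<in> A\<close>, conditional expectation the \<open>\<sigma>\<close>-algebra that they
  generate; preimages of a \<open>\<sigma>\<close>-algebra already form one, so the two agree.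
\<close>

lemma sets_generated_sigma_single:
  "sets (generated_sigma M Y {t}) = {Y t -` A \<inter> space M | A. A \<in> sets borel}"
proof -
  have "generated_sigma M Y {t} = vimage_algebra (space M) (Y t) borel"
    by (simp add: generated_sigma_def vimage_algebra_def)
  then show ?thesis
    by (simp add: sets_vimage_algebra2)
qed

lemma measurable_generated_sigma:
  assumes "i \<in> I"
  shows "Y i \<in> borel_measurable (generated_sigma M Y I)"
proof (rule measurableI)
  let ?G = "{Y i -` A \<inter> space M | i A. i \<in> I \<and> A \<in> sets borel}"
  have G: "?G \<subseteq> Pow (space M)"
    by blast
  show "Y i -` A \<inter> space (generated_sigma M Y I) \<in> sets (generated_sigma M Y I)"
    if "A \<in> sets borel" for A
    using that assms unfolding generated_sigma_def space_measure_of[OF G] sets_measure_of[OF G]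
    by (intro sigma_sets.Basic) blast
qed simp

lemma generated_sigma_mono:
  assumes "I \<subseteq> J"
  shows "sets (generated_sigma M Y I) \<subseteq> sets (generated_sigma M Y J)"
proof -
  let ?G = "\<lambda>K. {Y i -` A \<inter> space M | i A. i \<in> K \<and> A \<in> sets borel}"
  have G: "?G K \<subseteq> Pow (space M)" for K
    by blast
  have "?G I \<subseteq> ?G J"
    using assms by blast
  then show ?thesis
    unfolding generated_sigma_def sets_measure_of[OF G] by (rule sigma_sets_mono')
qed

lemma (in real_markov_process) subalgebra_past: "subalgebra M (generated_sigma M Y I)"
  by (rule subalgebra_generated_sigma) (rule measurable_Y)

lemma (in real_markov_process) finite_subalgebra_past: "finite_measure_subalgebra M (generated_sigma M Y I)"
  by unfold_locales (rule subalgebra_past)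

text \<open>
  The Markov property speaks about indicators of events \<open>Y\<^sub>t\<^sub>+\<^sub>1 \<in> A\<close>; here it is carried over to
  \<open>Y\<^sub>t\<^sub>+\<^sub>1\<close> itself. For an event \<open>B\<close> of the past put \<open>p = E(1\<^sub>B | Y\<^sub>t)\<close>. The property says that the law
  of \<open>Y\<^sub>t\<^sub>+\<^sub>1\<close> is the same whether \<open>M\<close> is weighted by \<open>1\<^sub>B\<close> or by \<open>p\<close>. Equal laws have
  equal means, so \<open>E(1\<^sub>B Y\<^sub>t\<^sub>+\<^sub>1) = E(p Y\<^sub>t\<^sub>+\<^sub>1)\<close>, and moving the conditioning from one factor to the
  other turns the right-hand side into \<open>E(1\<^sub>B E(Y\<^sub>t\<^sub>+\<^sub>1 | Y\<^sub>t))\<close>.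
\<close>

lemma (in real_markov_process) markov_cond_exp:
  assumes int: "integrable M (Y (Suc t))"
  shows "AE \<omega> in M. real_cond_exp M (generated_sigma M Y {..t}) (Y (Suc t)) \<omega>
      = real_cond_exp M (generated_sigma M Y {t}) (Y (Suc t)) \<omega>"
proof -
  let ?F = "generated_sigma M Y {..t}" and ?S = "generated_sigma M Y {t}"
  interpret F: finite_measure_subalgebra M ?F by (rule finite_subalgebra_past)
  interpret S: finite_measure_subalgebra M ?S by (rule finite_subalgebra_past)
  note measurable_Y [measurable]
  let ?g = "real_cond_exp M ?S (Y (Suc t))"
  have g_S [measurable]: "?g \<in> borel_measurable ?S" by simp
  have g_F: "?g \<in> borel_measurable ?F"
  proof (rule measurable_from_subalg[OF _ g_S])
    show "subalgebra ?F ?S"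
      using subalgebra_past[of "{..t}"] subalgebra_past[of "{t}"] generated_sigma_mono[of "{t}" "{..t}" M Y]
      by (simp add: subalgebra_def)
  qed
  have g_int: "integrable M ?g"
    by (rule S.real_cond_exp_int(1)[OF int])
  show ?thesis
  proof (rule F.real_cond_exp_charact[OF _ int g_int g_F])
    fix B assume BF: "B \<in> sets ?F"
    then have B [measurable]: "B \<in> sets M"
      using subalgebra_past[of "{..t}"] by (auto simp: subalgebra_def)
    have indicator_int: "integrable M (indicat_real A)" if "A \<in> sets M" for A
      using that by (intro integrable_real_indicator) (simp_all add: emeasure_eq_measure)
    have indB: "integrable M (indicat_real B)"
      by (rule indicator_int) (rule B)
    define p where "p = real_cond_exp M ?S (indicat_real B)"
    have p_S: "p \<in> borel_measurable ?S" and p_M [measurable]: "p \<in> borel_measurable M"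
      by (simp_all add: p_def)
    \<comment> \<open>the bounds \<open>0 \<le> p \<le> 1\<close> make \<open>p\<close> a density and keep products with \<open>p\<close> integrable\<close>
    have p_pos: "AE \<omega> in M. 0 \<le> p \<omega>" and p_le: "AE \<omega> in M. p \<omega> \<le> 1"
      unfolding p_def
      by (rule S.real_cond_exp_ge_c[OF indB], simp)
         (rule S.real_cond_exp_le_c[OF indB], simp add: indicator_def)
    have p_abs: "AE \<omega> in M. \<bar>p \<omega>\<bar> \<le> 1"
      using p_pos p_le by eventually_elim simp
    have p_mult_int: "integrable M (\<lambda>\<omega>. p \<omega> * f \<omega>)" if "integrable M f" for f
    proof (rule Bochner_Integration.integrable_bound[OF that])
      show "(\<lambda>\<omega>. p \<omega> * f \<omega>) \<in> borel_measurable M"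
        using that by measurable
      show "AE \<omega> in M. norm (p \<omega> * f \<omega>) \<le> norm (f \<omega>)"
        using p_abs by eventually_elim (simp add: abs_mult mult_left_le_one_le)
    qed
    have p_int: "integrable M p"
      using p_mult_int[of "\<lambda>_. 1"] by simp
    have hit: "(\<integral>\<omega>. indicat_real B \<omega> * indicat_real (Y (Suc t) -` A \<inter> space M) \<omega> \<partial>M)
        = (\<integral>\<omega>. p \<omega> * indicat_real (Y (Suc t) -` A \<inter> space M) \<omega> \<partial>M)" if A [measurable]: "A \<in> sets borel" for A
    proof -
      let ?V = "Y (Suc t) -` A \<inter> space M"
      have V [measurable]: "?V \<in> sets M" by measurable
      have V_int: "integrable M (indicat_real ?V)"
        by (rule indicator_int) simp
      have E_int: "integrable M (real_cond_exp M ?S (indicat_real ?V))"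
        by (rule S.real_cond_exp_int(1)[OF V_int])
      have "(\<integral>\<omega>. indicat_real B \<omega> * indicat_real ?V \<omega> \<partial>M)
          = (\<integral>\<omega>. indicat_real B \<omega> * real_cond_exp M ?F (indicat_real ?V) \<omega> \<partial>M)"
      proof (rule F.real_cond_exp_intg(2)[symmetric])
        show "integrable M (\<lambda>\<omega>. indicat_real B \<omega> * indicat_real ?V \<omega>)"
          by (rule integrable_real_mult_indicator[OF V indB])
        show "indicat_real B \<in> borel_measurable ?F"
          using BF by (rule borel_measurable_indicator)
        show "indicat_real ?V \<in> borel_measurable M"
          by measurable
      qed
      also have "\<dots> = (\<integral>\<omega>. real_cond_exp M ?S (indicat_real ?V) \<omega> * indicat_real B \<omega> \<partial>M)"
      proof (rule integral_cong_AE)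
        show "AE \<omega> in M. indicat_real B \<omega> * real_cond_exp M ?F (indicat_real ?V) \<omega>
            = real_cond_exp M ?S (indicat_real ?V) \<omega> * indicat_real B \<omega>"
          using markov[OF A, of t] by eventually_elim simp
      qed measurable
      also have "\<dots> = (\<integral>\<omega>. real_cond_exp M ?S (indicat_real ?V) \<omega> * p \<omega> \<partial>M)"
        unfolding p_def
        by (rule S.real_cond_exp_intg(2)[symmetric, OF integrable_real_mult_indicator[OF B E_int]])
           measurable
      also have "\<dots> = (\<integral>\<omega>. p \<omega> * real_cond_exp M ?S (indicat_real ?V) \<omega> \<partial>M)"
        by (simp only: mult.commute)
      also have "\<dots> = (\<integral>\<omega>. p \<omega> * indicat_real ?V \<omega> \<partial>M)"
        by (rule S.real_cond_exp_intg(2)[OF p_mult_int[OF V_int] p_S]) measurable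
      finally show ?thesis .
    qed
    have laws: "distr (density M (\<lambda>\<omega>. ennreal (indicat_real B \<omega>))) borel (Y (Suc t))
        = distr (density M (\<lambda>\<omega>. ennreal (p \<omega>))) borel (Y (Suc t))"
    proof (rule measure_eqI)
      fix A assume "A \<in> sets (distr (density M (\<lambda>\<omega>. ennreal (indicat_real B \<omega>))) borel (Y (Suc t)))"
      then have A [measurable]: "A \<in> sets borel" by simp
      let ?V = "Y (Suc t) -` A \<inter> space M"
      have V [measurable]: "?V \<in> sets M" by measurable
      have weigh: "emeasure (distr (density M (\<lambda>\<omega>. ennreal (q \<omega>))) borel (Y (Suc t))) A
          = ennreal (\<integral>\<omega>. q \<omega> * indicat_real ?V \<omega> \<partial>M)"
        if "q \<in> borel_measurable M" "AE \<omega> in M. 0 \<le> q \<omega>" "integrable M q" for q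
      proof -
        have [measurable]: "q \<in> borel_measurable M" by fact
        have "emeasure (distr (density M (\<lambda>\<omega>. ennreal (q \<omega>))) borel (Y (Suc t))) A
            = (\<integral>\<^sup>+\<omega>. ennreal (q \<omega>) * indicator ?V \<omega> \<partial>M)"
          by (simp add: emeasure_distr emeasure_density)
        also have "\<dots> = (\<integral>\<^sup>+\<omega>. ennreal (q \<omega> * indicat_real ?V \<omega>) \<partial>M)"
          by (intro nn_integral_cong) (simp add: indicator_def)
        also have "\<dots> = ennreal (\<integral>\<omega>. q \<omega> * indicat_real ?V \<omega> \<partial>M)"
          using that by (intro nn_integral_eq_integral integrable_real_mult_indicator) auto
        finally show ?thesis .
      qed
      show "emeasure (distr (density M (\<lambda>\<omega>. ennreal (indicat_real B \<omega>))) borel (Y (Suc t))) A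
          = emeasure (distr (density M (\<lambda>\<omega>. ennreal (p \<omega>))) borel (Y (Suc t))) A"
        using weigh[OF _ _ indB] weigh[OF p_M p_pos p_int] hit[OF A] by simp
    qed simp
    have reweigh: "(\<integral>y. y \<partial>distr (density M (\<lambda>\<omega>. ennreal (q \<omega>))) borel (Y (Suc t)))
        = (\<integral>\<omega>. q \<omega> * Y (Suc t) \<omega> \<partial>M)"
      if [measurable]: "q \<in> borel_measurable M" and pos: "AE \<omega> in M. 0 \<le> q \<omega>" for q
    proof -
      have "(\<integral>y. y \<partial>distr (density M (\<lambda>\<omega>. ennreal (q \<omega>))) borel (Y (Suc t)))
          = (\<integral>\<omega>. Y (Suc t) \<omega> \<partial>density M (\<lambda>\<omega>. ennreal (q \<omega>)))"
        by (rule integral_distr) measurable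
      also have "\<dots> = (\<integral>\<omega>. q \<omega> * Y (Suc t) \<omega> \<partial>M)"
        using pos by (intro integral_real_density) measurable
      finally show ?thesis .
    qed
    have "(\<integral>\<omega>. indicat_real B \<omega> * Y (Suc t) \<omega> \<partial>M) = (\<integral>\<omega>. p \<omega> * Y (Suc t) \<omega> \<partial>M)"
      using reweigh[of "indicat_real B"] reweigh[OF p_M p_pos] by (simp add: laws)
    also have "\<dots> = (\<integral>\<omega>. p \<omega> * ?g \<omega> \<partial>M)"
      by (rule S.real_cond_exp_intg(2)[symmetric, OF p_mult_int[OF int] p_S]) measurable
    also have "\<dots> = (\<integral>\<omega>. ?g \<omega> * p \<omega> \<partial>M)"
      by (simp only: mult.commute)
    also have "\<dots> = (\<integral>\<omega>. ?g \<omega> * indicat_real B \<omega> \<partial>M)"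
      unfolding p_def
      by (rule S.real_cond_exp_intg(2)[OF integrable_real_mult_indicator[OF B g_int] g_S]) measurable
    finally show "(\<integral>\<omega>\<in>B. Y (Suc t) \<omega> \<partial>M) = (\<integral>\<omega>\<in>B. ?g \<omega> \<partial>M)"
      by (simp add: set_lebesgue_integral_def mult.commute)
  qed
qed

lemma (in real_markov_process) cond_exp_indep_noise:
  assumes "indep_var borel (Y t) borel W" "integrable M W" "expectation W = 0"
  shows "AE \<omega> in M. real_cond_exp M (generated_sigma M Y {t}) W \<omega> = 0"
proof -
  interpret S: finite_measure_subalgebra M "generated_sigma M Y {t}" by (rule finite_subalgebra_past)
  show ?thesis
  proof (rule S.real_cond_exp_charact)
    fix A assume "A \<in> sets (generated_sigma M Y {t})"
    then obtain D where D [measurable]: "D \<in> sets borel" and A: "A = Y t -` D \<inter> space M"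
      by (auto simp: sets_generated_sigma_single)
    have "indep_var borel (indicat_real D \<circ> Y t) borel ((\<lambda>x. x) \<circ> W)"
      by (rule indep_var_compose[OF assms(1)]) auto
    then have ind: "indep_var borel (\<lambda>\<omega>. indicat_real D (Y t \<omega>)) borel W"
      by (simp add: comp_def)
    have "(\<integral>\<omega>\<in>A. W \<omega> \<partial>M) = (\<integral>\<omega>. indicat_real D (Y t \<omega>) * W \<omega> \<partial>M)"
      unfolding set_lebesgue_integral_def A
      by (rule Bochner_Integration.integral_cong) (auto simp: indicator_def)
    also have "\<dots> = (\<integral>\<omega>. indicat_real D (Y t \<omega>) \<partial>M) * (\<integral>\<omega>. W \<omega> \<partial>M)"
      using measurable_Y[of t]
      by (intro indep_var_lebesgue_integral ind assms integrable_const_bound[where B = 1]) auto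
    finally show "(\<integral>\<omega>\<in>A. W \<omega> \<partial>M) = (\<integral>\<omega>\<in>A. 0 \<partial>M)"
      by (simp add: assms)
  qed (auto simp: assms)
qed

section \<open>The standard deviation of the walk\<close>

text \<open>
  The standard deviation of \<open>Y\<^sub>t\<close>. Starting at time \<open>0\<close> with value \<open>0\<close> makes the recursion give \<open>\<sigma>\<close> at
  time \<open>1\<close>, as it must since \<open>Y\<^sub>1 = \<xi>\<^sub>1\<close>.
\<close>

primrec walk_sd :: "real \<Rightarrow> real \<Rightarrow> nat \<Rightarrow> real" where
  "walk_sd \<rho> \<sigma> 0 = 0"
| "walk_sd \<rho> \<sigma> (Suc t) = sqrt ((walk_sd \<rho> \<sigma> t)\<^sup>2 + 2 * \<rho> * \<sigma> * walk_sd \<rho> \<sigma> t + \<sigma>\<^sup>2)"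

text \<open>
  Completing the square exhibits a positive lower bound for the variance, and shows that the next
  standard deviation is at least \<open>\<bar>v + \<rho>\<sigma>\<bar>\<close>.
\<close>

lemma sum_variance_complete_square:
  "v\<^sup>2 + 2 * \<rho> * \<sigma> * v + \<sigma>\<^sup>2 = (v + \<rho> * \<sigma>)\<^sup>2 + \<sigma>\<^sup>2 * (1 - \<rho>\<^sup>2)" for v \<rho> \<sigma> :: real
  by (simp add: power2_eq_square algebra_simps)

lemma walk_sd_pos:
  assumes "\<bar>\<rho>\<bar> < 1" "0 < \<sigma>"
  shows "0 < walk_sd \<rho> \<sigma> (Suc t)"
proof -
  have "0 < \<sigma>\<^sup>2 * (1 - \<rho>\<^sup>2)"
    using assms by (intro mult_pos_pos) (simp_all add: abs_square_less_1)
  then show ?thesis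
    by (simp add: sum_variance_complete_square add_nonneg_pos)
qed

text \<open>
  The limit \<open>L\<close> is the fixed point of the recursion \<open>v \<mapsto> v'\<close>. Subtracting the equations for \<open>v'\<^sup>2\<close> and \<open>L\<^sup>2\<close>
  gives \<open>(v' - L) (v' + L) = (v - L) (v + L + 2\<rho>\<sigma>)\<close>, and
  \<open>\<bar>v + L + 2\<rho>\<sigma>\<bar> \<le> \<bar>v + \<rho>\<sigma>\<bar> + \<bar>L + \<rho>\<sigma>\<bar> \<le> v' + L - \<delta>\<close> with
  \<open>\<delta> = L - \<bar>L + \<rho>\<sigma>\<bar> > 0\<close>. So the distance to \<open>L\<close> shrinks at each step by the factor
  \<open>1 - \<delta> / (v' + L)\<close>, which stays away from \<open>1\<close> because \<open>v'\<close> never exceeds \<open>2L\<close>. A monotone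
  convergence argument is not available for all \<open>\<rho>\<close>: for \<open>\<rho>\<^sup>2 > 1/2\<close> the map \<open>v \<mapsto> v'\<close> is decreasing near \<open>L\<close>.
\<close>

lemma walk_sd_tendsto:
  assumes "\<rho> \<in> {-1<..<0}" "0 < \<sigma>"
  shows "walk_sd \<rho> \<sigma> \<longlonglongrightarrow> - \<sigma> / (2 * \<rho>)"
proof -
  let ?v = "walk_sd \<rho> \<sigma>"
  define L where "L = - \<sigma> / (2 * \<rho>)"
  define \<delta> where "\<delta> = L - \<bar>L + \<rho> * \<sigma>\<bar>"
  have \<rho>: "-1 < \<rho>" "\<rho> < 0" "\<bar>\<rho>\<bar> < 1"
    using assms by auto
  have "0 < L"
    using assms by (simp add: L_def divide_less_0_iff)
  have \<rho>\<sigma>L: "2 * \<rho> * L = - \<sigma>"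
    using \<rho> by (simp add: L_def)
  have "\<rho> * \<sigma> < 0"
    using assms by (simp add: mult_neg_pos)
  have "0 < 2 * L + \<rho> * \<sigma>"
  proof -
    have "\<rho>\<^sup>2 < 1"
      using \<rho> by (simp add: abs_square_less_1)
    moreover have "(- \<rho>) * (2 * L + \<rho> * \<sigma>) = \<sigma> * (1 - \<rho>\<^sup>2)"
      using \<rho>\<sigma>L by (simp add: algebra_simps power2_eq_square)
    ultimately have "0 < (- \<rho>) * (2 * L + \<rho> * \<sigma>)"
      using assms by simp
    then show ?thesis
      by (rule zero_less_mult_pos) (use \<rho> in simp)
  qed
  \<comment> \<open>the two cases of the absolute value give \<open>\<delta> = -\<rho>\<sigma>\<close> or \<open>\<delta> = 2L + \<rho>\<sigma>\<close>\<close>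
  with \<open>\<rho> * \<sigma> < 0\<close> have "0 < \<delta>" "\<delta> \<le> L"
    by (auto simp: \<delta>_def)
  have v_nonneg: "0 \<le> ?v t" for t
    using walk_sd_pos[OF \<rho>(3) assms(2)] by (cases t) (auto intro: less_imp_le)
  have step: "\<bar>?v (Suc t) - L\<bar> * (?v (Suc t) + L) \<le> \<bar>?v t - L\<bar> * (?v (Suc t) + L - \<delta>)" for t
  proof -
    have nonneg: "0 \<le> (?v t + \<rho> * \<sigma>)\<^sup>2 + \<sigma>\<^sup>2 * (1 - \<rho>\<^sup>2)" and sq: "(?v t + \<rho> * \<sigma>)\<^sup>2 \<le> (?v t + \<rho> * \<sigma>)\<^sup>2 + \<sigma>\<^sup>2 * (1 - \<rho>\<^sup>2)"
      using \<rho> by (simp_all add: abs_square_le_1)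
    have "\<bar>?v t + \<rho> * \<sigma>\<bar> \<le> ?v (Suc t)"
      using real_sqrt_le_mono[OF sq] by (simp add: sum_variance_complete_square)
    then have "\<bar>?v t + L + 2 * \<rho> * \<sigma>\<bar> \<le> ?v (Suc t) + L - \<delta>"
      unfolding \<delta>_def by linarith
    moreover have "\<bar>?v (Suc t) - L\<bar> * (?v (Suc t) + L) = \<bar>?v t - L\<bar> * \<bar>?v t + L + 2 * \<rho> * \<sigma>\<bar>"
    proof -
      have "(?v (Suc t))\<^sup>2 = (?v t)\<^sup>2 + 2 * \<rho> * \<sigma> * ?v t + \<sigma>\<^sup>2"
        using nonneg by (simp add: sum_variance_complete_square)
      moreover have "\<sigma>\<^sup>2 = - (2 * \<rho> * L) * \<sigma>"
        by (simp add: \<rho>\<sigma>L power2_eq_square)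
      moreover have "(?v (Suc t) - L) * (?v (Suc t) + L) = (?v (Suc t))\<^sup>2 - L\<^sup>2"
        by (simp add: power2_eq_square algebra_simps del: walk_sd.simps)
      ultimately have "(?v (Suc t) - L) * (?v (Suc t) + L) = (?v t - L) * (?v t + L + 2 * \<rho> * \<sigma>)"
        by (simp only:) (simp add: power2_eq_square algebra_simps)
      then show ?thesis
        using v_nonneg[of "Suc t"] \<open>0 < L\<close> by (metis abs_mult abs_of_nonneg add_nonneg_nonneg less_imp_le)
    qed
    ultimately show ?thesis
      by (simp add: mult_left_mono del: walk_sd.simps)
  qed
  have decr: "\<bar>?v (Suc t) - L\<bar> \<le> (1 - \<delta> / (?v (Suc t) + L)) * \<bar>?v t - L\<bar>" for t
  proof -
    have "0 < ?v (Suc t) + L"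
      using v_nonneg[of "Suc t"] \<open>0 < L\<close> by (simp del: walk_sd.simps)
    then show ?thesis
      using step[of t] by (simp add: field_simps del: walk_sd.simps)
  qed
  have bound: "\<bar>?v t - L\<bar> \<le> L" for t
  proof (induction t)
    case 0
    then show ?case using \<open>0 < L\<close> by simp
  next
    case (Suc t)
    have "0 \<le> \<delta> / (?v (Suc t) + L)"
      using v_nonneg[of "Suc t"] \<open>0 < L\<close> \<open>0 < \<delta>\<close> by (simp del: walk_sd.simps)
    then have "(1 - \<delta> / (?v (Suc t) + L)) * \<bar>?v t - L\<bar> \<le> 1 * \<bar>?v t - L\<bar>"
      by (intro mult_right_mono) (simp_all del: walk_sd.simps)
    also have "\<dots> \<le> L"
      using Suc.IH by simp
    finally show ?case
      using decr[of t] by (rule order_trans[rotated])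
  qed
  define q where "q = 1 - \<delta> / (3 * L)"
  have q: "0 \<le> q" "q < 1"
    using \<open>0 < \<delta>\<close> \<open>\<delta> \<le> L\<close> \<open>0 < L\<close> by (simp_all add: q_def field_simps)
  have geometric: "\<bar>?v t - L\<bar> \<le> q ^ t * L" for t
  proof (induction t)
    case 0
    then show ?case using \<open>0 < L\<close> by simp
  next
    case (Suc t)
    have "0 < ?v (Suc t) + L" "?v (Suc t) + L \<le> 3 * L"
      using bound[of "Suc t"] v_nonneg[of "Suc t"] \<open>0 < L\<close> by linarith+
    then have "1 - \<delta> / (?v (Suc t) + L) \<le> q"
      unfolding q_def using \<open>0 < \<delta>\<close> \<open>0 < L\<close> by (simp add: frac_le del: walk_sd.simps)
    then have "(1 - \<delta> / (?v (Suc t) + L)) * \<bar>?v t - L\<bar> \<le> q * \<bar>?v t - L\<bar>"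
      by (rule mult_right_mono) simp
    also have "\<dots> \<le> q * (q ^ t * L)"
      using Suc.IH q by (intro mult_left_mono)
    finally show ?case
      using decr[of t] by (simp add: mult.assoc del: walk_sd.simps)
  qed
  have "(\<lambda>t. q ^ t * L) \<longlonglongrightarrow> 0"
    using q by (auto intro!: tendsto_eq_intros LIMSEQ_power_zero)
  then have "(\<lambda>t. ?v t - L) \<longlonglongrightarrow> 0"
    by (rule Lim_null_comparison[rotated]) (simp add: geometric)
  then show ?thesis
    unfolding L_def by (rule LIM_zero_cancel)
qed

section \<open>Autocovariances of the innovations\<close>

lemma (in prob_space) normal_moments:
  assumes D: "distributed M lborel X (normal_density 0 a)" and "0 < a"
  shows "integrable M X" "expectation X = 0" "integrable M (\<lambda>\<omega>. (X \<omega>)\<^sup>2)" "expectation (\<lambda>\<omega>. (X \<omega>)\<^sup>2) = a\<^sup>2"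
proof -
  show "integrable M X"
    using distributed_integrable[OF D, of "\<lambda>x. x"] integrable_normal_moment[of a 0 1] \<open>0 < a\<close> by simp
  show E: "expectation X = 0"
    using normal_distributed_expectation[OF \<open>0 < a\<close> D] .
  show "integrable M (\<lambda>\<omega>. (X \<omega>)\<^sup>2)"
    using distributed_integrable[OF D, of "\<lambda>x. x\<^sup>2"] integrable_normal_moment[of a 0 2] \<open>0 < a\<close> by simp
  show "expectation (\<lambda>\<omega>. (X \<omega>)\<^sup>2) = a\<^sup>2"
    using normal_distributed_variance[OF \<open>0 < a\<close> D] by (simp add: E)
qed

lemma integrable_product_of_squares:
  fixes X Z :: "'a \<Rightarrow> real"
  assumes [measurable]: "X \<in> borel_measurable M" "Z \<in> borel_measurable M"
    and "integrable M (\<lambda>\<omega>. (X \<omega>)\<^sup>2)" "integrable M (\<lambda>\<omega>. (Z \<omega>)\<^sup>2)"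
  shows "integrable M (\<lambda>\<omega>. X \<omega> * Z \<omega>)"
proof (rule Bochner_Integration.integrable_bound)
  show "integrable M (\<lambda>\<omega>. (X \<omega>)\<^sup>2 + (Z \<omega>)\<^sup>2)"
    using assms by simp
  have "\<bar>x * z\<bar> \<le> x\<^sup>2 + z\<^sup>2" for x z :: real
  proof -
    have "2 * \<bar>x * z\<bar> \<le> x\<^sup>2 + z\<^sup>2"
      using sum_squares_bound[of "\<bar>x\<bar>" "\<bar>z\<bar>"] by (simp add: abs_mult mult.assoc)
    then show ?thesis
      using abs_ge_zero[of "x * z"] by linarith
  qed
  then show "AE \<omega> in M. norm (X \<omega> * Z \<omega>) \<le> norm ((X \<omega>)\<^sup>2 + (Z \<omega>)\<^sup>2)"
    by simp
qed simp

context gaussian_convolution_markov_process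
begin

context
  assumes \<rho>: "\<bar>\<rho>\<bar> < 1" and \<sigma>: "0 < \<sigma>"
begin

abbreviation sd :: "nat \<Rightarrow> real" where "sd \<equiv> walk_sd \<rho> \<sigma>"

lemma measurable_innovation: "1 \<le> t \<Longrightarrow> \<xi> t \<in> borel_measurable M"
  using distributed_measurable[OF innovation_normal] by simp

lemma sd_pos: "1 \<le> t \<Longrightarrow> 0 < sd t"
  using walk_sd_pos[OF \<rho> \<sigma>] by (cases t) auto

lemma normal_Y: "1 \<le> t \<Longrightarrow> distributed M lborel (Y t) (normal_density 0 (sd t))"
proof (induction t rule: dec_induct)
  case base
  have "Y 1 \<omega> = \<xi> 1 \<omega>" if "\<omega> \<in> space M" for \<omega>
    using Y_step[of 1] Y_0 that by simp
  then have "distr M lborel (Y 1) = distr M lborel (\<xi> 1)"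
    by (intro distr_cong) auto
  then show ?case
    using innovation_normal[of 1] measurable_Y[of 1] \<sigma> by (simp add: distributed_def)
next
  case (step t)
  obtain C where C: "gaussian_copula \<rho> C" "copula_of M (Y t) (\<xi> (Suc t)) C"
    using innovation_copula step.hyps by (metis One_nat_def Suc_le_mono diff_Suc_1 numeral_2_eq_2)
  have "distributed M lborel (\<lambda>\<omega>. Y t \<omega> + \<xi> (Suc t) \<omega>)
      (normal_density 0 (sqrt ((sd t)\<^sup>2 + 2 * \<rho> * \<sigma> * sd t + \<sigma>\<^sup>2)))"
    by (rule gaussian_copula_regression[OF \<rho> C sd_pos[OF step.hyps(1)] \<sigma> step.IH innovation_normal]) simp_all
  moreover have "distr M lborel (Y (Suc t)) = distr M lborel (\<lambda>\<omega>. Y t \<omega> + \<xi> (Suc t) \<omega>)"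
    by (intro distr_cong) (auto simp: Y_step)
  ultimately show ?case
    using measurable_Y[of "Suc t"] by (simp add: distributed_def)
qed

text \<open>
  The gaussian copula makes \<open>E(\<xi>\<^sub>t\<^sub>+\<^sub>1 | Y\<^sub>t)\<close> linear in \<open>Y\<^sub>t\<close>, and the Markov property replaces the
  condition \<open>Y\<^sub>t\<close> by the whole past. Everything about autocovariances follows from this identity.
\<close>

lemma cond_exp_next:
  assumes t: "1 \<le> t"
  shows "AE \<omega> in M. real_cond_exp M (generated_sigma M Y {..t}) (Y (Suc t)) \<omega> = (1 + \<rho> * \<sigma> / sd t) * Y t \<omega>"
proof -
  interpret S: finite_measure_subalgebra M "generated_sigma M Y {t}" by (rule finite_subalgebra_past)
  obtain C where C: "gaussian_copula \<rho> C" "copula_of M (Y t) (\<xi> (Suc t)) C"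
    using innovation_copula t by (metis One_nat_def Suc_le_mono diff_Suc_1 numeral_2_eq_2)
  obtain W where W: "indep_var borel (Y t) borel W" "distributed M lborel W std_normal_density"
    "\<And>\<omega>. \<xi> (Suc t) \<omega> = \<sigma> * \<rho> / sd t * Y t \<omega> + \<sigma> * sqrt (1 - \<rho>\<^sup>2) * W \<omega>"
  proof (rule gaussian_copula_regression[OF \<rho> C sd_pos[OF t] \<sigma> normal_Y[OF t] innovation_normal])
    show "1 \<le> Suc t" by simp
  qed (rule that)
  let ?c = "1 + \<rho> * \<sigma> / sd t" and ?d = "\<sigma> * sqrt (1 - \<rho>\<^sup>2)"
  have intY: "integrable M (Y s)" if "1 \<le> s" for s
    using normal_moments[OF normal_Y sd_pos] that by blast
  have W_mom: "integrable M W" "expectation W = 0"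
    using normal_moments[OF W(2)] by simp_all
  have [measurable]: "W \<in> borel_measurable M" "Y s \<in> borel_measurable M" for s
    using W_mom(1) measurable_Y by auto
  have cY: "integrable M (\<lambda>\<omega>. ?c * Y t \<omega>)" "integrable M (\<lambda>\<omega>. ?d * W \<omega>)"
    using intY[OF t] W_mom by auto
  have "AE \<omega> in M. Y (Suc t) \<omega> = ?c * Y t \<omega> + ?d * W \<omega>"
    by (rule AE_I2) (simp add: Y_step W(3) algebra_simps)
  then have "AE \<omega> in M. real_cond_exp M (generated_sigma M Y {t}) (Y (Suc t)) \<omega>
      = real_cond_exp M (generated_sigma M Y {t}) (\<lambda>\<omega>. ?c * Y t \<omega> + ?d * W \<omega>) \<omega>"
    by (rule S.real_cond_exp_cong) measurable
  moreover have "AE \<omega> in M. real_cond_exp M (generated_sigma M Y {t}) (\<lambda>\<omega>. ?c * Y t \<omega> + ?d * W \<omega>) \<omega>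
      = real_cond_exp M (generated_sigma M Y {t}) (\<lambda>\<omega>. ?c * Y t \<omega>) \<omega>
      + real_cond_exp M (generated_sigma M Y {t}) (\<lambda>\<omega>. ?d * W \<omega>) \<omega>"
    by (rule S.real_cond_exp_add[OF cY])
  moreover have "AE \<omega> in M. real_cond_exp M (generated_sigma M Y {t}) (\<lambda>\<omega>. ?c * Y t \<omega>) \<omega> = ?c * Y t \<omega>"
    by (rule S.real_cond_exp_F_meas[OF cY(1)])
       (intro borel_measurable_times borel_measurable_const measurable_generated_sigma, simp)
  moreover have "AE \<omega> in M. real_cond_exp M (generated_sigma M Y {t}) (\<lambda>\<omega>. ?d * W \<omega>) \<omega>
      = ?d * real_cond_exp M (generated_sigma M Y {t}) W \<omega>"
    by (rule S.real_cond_exp_cmult[OF W_mom(1)])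
  moreover note cond_exp_indep_noise[OF W(1) W_mom]
  moreover note markov_cond_exp[OF intY[OF le_SucI[OF t]]]
  ultimately show ?thesis
    by eventually_elim simp
qed

text \<open>
  Conditioning successively on each later past peels off one factor at a time from the expectation of
  a past variable times a future position. The case needed for the autocorrelation is \<open>Z = \<xi>\<^sub>t\<close>; the case
  \<open>Z = Y\<^sub>t\<close> supplies its initial value.
\<close>

context
  fixes Z :: "'a \<Rightarrow> real" and t :: nat
  assumes t: "1 \<le> t"
    and Z_past: "Z \<in> borel_measurable (generated_sigma M Y {..t})"
    and Z_sq: "integrable M (\<lambda>\<omega>. (Z \<omega>)\<^sup>2)"
begin

lemma past_later: "Z \<in> borel_measurable (generated_sigma M Y {..t + j})"
proof (rule measurable_from_subalg[OF _ Z_past])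
  show "subalgebra (generated_sigma M Y {..t + j}) (generated_sigma M Y {..t})"
    using subalgebra_past[of "{..t}"] subalgebra_past[of "{..t + j}"]
      generated_sigma_mono[of "{..t}" "{..t + j}" M Y]
    by (simp add: subalgebra_def)
qed

lemma integrable_past_times_Y: "1 \<le> s \<Longrightarrow> integrable M (\<lambda>\<omega>. Z \<omega> * Y s \<omega>)"
  using Z_sq normal_moments(3)[OF normal_Y sd_pos] measurable_Y
    measurable_from_subalg[OF subalgebra_past Z_past]
  by (intro integrable_product_of_squares) auto

lemma past_times_next:
  "expectation (\<lambda>\<omega>. Z \<omega> * Y (Suc (t + j)) \<omega>) = (1 + \<rho> * \<sigma> / sd (t + j)) * expectation (\<lambda>\<omega>. Z \<omega> * Y (t + j) \<omega>)"
proof -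
  let ?F = "generated_sigma M Y {..t + j}"
  interpret F: finite_measure_subalgebra M ?F by (rule finite_subalgebra_past)
  have [measurable]: "Z \<in> borel_measurable M" "Y s \<in> borel_measurable M" for s
    using measurable_from_subalg[OF subalgebra_past Z_past] measurable_Y by auto
  have "expectation (\<lambda>\<omega>. Z \<omega> * Y (Suc (t + j)) \<omega>) = expectation (\<lambda>\<omega>. Z \<omega> * real_cond_exp M ?F (Y (Suc (t + j))) \<omega>)"
    by (rule F.real_cond_exp_intg(2)[symmetric, OF integrable_past_times_Y past_later]) auto
  also have "\<dots> = expectation (\<lambda>\<omega>. (1 + \<rho> * \<sigma> / sd (t + j)) * (Z \<omega> * Y (t + j) \<omega>))"
  proof (rule integral_cong_AE)
    have "AE \<omega> in M. real_cond_exp M ?F (Y (Suc (t + j))) \<omega> = (1 + \<rho> * \<sigma> / sd (t + j)) * Y (t + j) \<omega>"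
      using t by (intro cond_exp_next) simp
    then show "AE \<omega> in M. Z \<omega> * real_cond_exp M ?F (Y (Suc (t + j))) \<omega>
        = (1 + \<rho> * \<sigma> / sd (t + j)) * (Z \<omega> * Y (t + j) \<omega>)"
      by eventually_elim simp
  qed measurable
  finally show ?thesis by simp
qed

lemma past_times_Y:
  "expectation (\<lambda>\<omega>. Z \<omega> * Y (t + j) \<omega>) = (\<Prod>i<j. 1 + \<rho> * \<sigma> / sd (t + i)) * expectation (\<lambda>\<omega>. Z \<omega> * Y t \<omega>)"
proof (induction j)
  case (Suc j)
  then show ?case
    by (simp only: add_Suc_right past_times_next prod.lessThan_Suc) (simp only: ac_simps)
qed simp

lemma past_times_innovation:
  "expectation (\<lambda>\<omega>. Z \<omega> * \<xi> (Suc (t + j)) \<omega>)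
     = \<rho> * \<sigma> / sd (t + j) * (\<Prod>i<j. 1 + \<rho> * \<sigma> / sd (t + i)) * expectation (\<lambda>\<omega>. Z \<omega> * Y t \<omega>)"
proof -
  have "expectation (\<lambda>\<omega>. Z \<omega> * \<xi> (Suc (t + j)) \<omega>)
      = expectation (\<lambda>\<omega>. Z \<omega> * Y (Suc (t + j)) \<omega> - Z \<omega> * Y (t + j) \<omega>)"
    by (rule Bochner_Integration.integral_cong[OF refl]) (simp add: Y_step[of "Suc (t + j)"] distrib_left)
  also have "\<dots> = expectation (\<lambda>\<omega>. Z \<omega> * Y (Suc (t + j)) \<omega>) - expectation (\<lambda>\<omega>. Z \<omega> * Y (t + j) \<omega>)"
    using t by (intro Bochner_Integration.integral_diff integrable_past_times_Y) auto
  also have "\<dots> = \<rho> * \<sigma> / sd (t + j) * expectation (\<lambda>\<omega>. Z \<omega> * Y (t + j) \<omega>)"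
    by (simp add: past_times_next distrib_right)
  finally show ?thesis
    by (simp add: past_times_Y)
qed

end

lemma innovation_moments:
  assumes "1 \<le> t"
  shows "expectation (\<xi> t) = 0" "integrable M (\<lambda>\<omega>. (\<xi> t \<omega>)\<^sup>2)" "expectation (\<lambda>\<omega>. (\<xi> t \<omega>)\<^sup>2) = \<sigma>\<^sup>2"
  using normal_moments[OF innovation_normal[OF assms] \<sigma>] by simp_all

lemma innovation_times_Y:
  assumes t: "1 \<le> t"
  shows "expectation (\<lambda>\<omega>. \<xi> (Suc t) \<omega> * Y (Suc t) \<omega>) = \<sigma>\<^sup>2 + \<rho> * \<sigma> * sd t"
proof -
  have Y_meas: "Y t \<in> borel_measurable (generated_sigma M Y {..t})"
    by (rule measurable_generated_sigma) simp
  note Y_mom = normal_moments[OF normal_Y[OF t] sd_pos[OF t]]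
  have cross: "expectation (\<lambda>\<omega>. Y t \<omega> * \<xi> (Suc t) \<omega>) = \<rho> * \<sigma> * sd t"
    using past_times_innovation[OF t Y_meas Y_mom(3), of 0] Y_mom(4) sd_pos[OF t]
    by (simp add: power2_eq_square)
  have "expectation (\<lambda>\<omega>. \<xi> (Suc t) \<omega> * Y (Suc t) \<omega>) = expectation (\<lambda>\<omega>. (\<xi> (Suc t) \<omega>)\<^sup>2 + Y t \<omega> * \<xi> (Suc t) \<omega>)"
    by (rule Bochner_Integration.integral_cong[OF refl]) (simp_all add: Y_step[of "Suc t"] power2_eq_square algebra_simps)
  also have "\<dots> = expectation (\<lambda>\<omega>. (\<xi> (Suc t) \<omega>)\<^sup>2) + expectation (\<lambda>\<omega>. Y t \<omega> * \<xi> (Suc t) \<omega>)"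
    using innovation_moments[of "Suc t"] Y_mom(3) measurable_Y[of t] measurable_innovation[of "Suc t"]
    by (intro Bochner_Integration.integral_add integrable_product_of_squares) auto
  finally show ?thesis
    using innovation_moments[of "Suc t"] cross by simp
qed

text \<open>
  The innovation is replaced by the increment \<open>Y\<^sub>t\<^sub>+\<^sub>1 - Y\<^sub>t\<close>, which is measurable with respect to the
  natural filtration by construction. The last factor is \<open>E(\<xi>\<^sub>t\<^sub>+\<^sub>1 Y\<^sub>t\<^sub>+\<^sub>1) / \<sigma>\<^sup>2\<close>.
\<close>

lemma corr_innovations:
  assumes t: "1 \<le> t"
  shows "corr M (\<xi> (Suc t)) (\<xi> (Suc t + Suc j))
     = \<rho> * \<sigma> / sd (Suc t + j) * (\<Prod>i<j. 1 + \<rho> * \<sigma> / sd (Suc t + i)) * (1 + \<rho> * sd t / \<sigma>)"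
proof -
  let ?Z = "\<lambda>\<omega>. Y (Suc t) \<omega> - Y t \<omega>"
  have Z: "?Z \<omega> = \<xi> (Suc t) \<omega>" if "\<omega> \<in> space M" for \<omega>
    using Y_step[of "Suc t"] that by simp
  have Z_past: "?Z \<in> borel_measurable (generated_sigma M Y {..Suc t})"
    by (intro borel_measurable_diff measurable_generated_sigma) auto
  have "integrable M (\<lambda>\<omega>. (?Z \<omega>)\<^sup>2) \<longleftrightarrow> integrable M (\<lambda>\<omega>. (\<xi> (Suc t) \<omega>)\<^sup>2)"
    by (rule Bochner_Integration.integrable_cong) (simp_all add: Z)
  then have Z_sq: "integrable M (\<lambda>\<omega>. (?Z \<omega>)\<^sup>2)"
    using innovation_moments[of "Suc t"] by simp
  have ZX: "expectation (\<lambda>\<omega>. ?Z \<omega> * X \<omega>) = expectation (\<lambda>\<omega>. \<xi> (Suc t) \<omega> * X \<omega>)" for X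
    by (rule Bochner_Integration.integral_cong[OF refl]) (simp_all add: Z)
  have "covariance M (\<xi> (Suc t)) (\<xi> (Suc t + Suc j)) = expectation (\<lambda>\<omega>. \<xi> (Suc t) \<omega> * \<xi> (Suc (Suc t + j)) \<omega>)"
    using innovation_moments[of "Suc t"] innovation_moments[of "Suc (Suc t + j)"] by (simp add: covariance_def)
  also have "\<dots> = \<rho> * \<sigma> / sd (Suc t + j) * (\<Prod>i<j. 1 + \<rho> * \<sigma> / sd (Suc t + i)) * (\<sigma>\<^sup>2 + \<rho> * \<sigma> * sd t)"
    using past_times_innovation[OF _ Z_past Z_sq, of j] by (simp only: ZX innovation_times_Y[OF t])
  also have "\<sigma>\<^sup>2 + \<rho> * \<sigma> * sd t = (1 + \<rho> * sd t / \<sigma>) * \<sigma>\<^sup>2"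
    using \<sigma> by (simp add: power2_eq_square field_simps)
  finally have cov: "covariance M (\<xi> (Suc t)) (\<xi> (Suc t + Suc j))
      = \<rho> * \<sigma> / sd (Suc t + j) * (\<Prod>i<j. 1 + \<rho> * \<sigma> / sd (Suc t + i)) * (1 + \<rho> * sd t / \<sigma>) * \<sigma>\<^sup>2"
    by (simp only: mult.assoc)
  have var: "sqrt (covariance M (\<xi> s) (\<xi> s)) = \<sigma>" if "1 \<le> s" for s
    using innovation_moments[OF that] \<sigma> by (simp add: covariance_def power2_eq_square[symmetric])
  have pos_index: "1 \<le> Suc t" "1 \<le> Suc t + Suc j"
    by simp_all
  show ?thesis
    unfolding corr_def cov var[OF pos_index(1)] var[OF pos_index(2)]
    using \<sigma> by (simp only: power2_eq_square) simp
qed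

end

end

theorem proposition3p2:
  fixes M :: "'a measure" and Y \<xi> :: "nat \<Rightarrow> 'a \<Rightarrow> real" and \<rho> \<sigma> :: real and k :: nat
  assumes "0 < \<sigma>"
    and "\<rho> \<in> {-1<..<0}"
    and "gaussian_convolution_markov_process M Y \<xi> \<rho> \<sigma>"
    and "1 \<le> k"
  shows "(\<lambda>t. corr M (\<xi> t) (\<xi> (t + k))) \<longlonglongrightarrow> - \<rho>\<^sup>2 * (1 - 2 * \<rho>\<^sup>2) ^ (k - 1)"
proof -
  interpret gaussian_convolution_markov_process M Y \<xi> \<rho> \<sigma> by fact
  have \<rho>: "\<bar>\<rho>\<bar> < 1" "\<rho> \<noteq> 0"
    using assms by auto
  obtain j where k: "k = Suc j"
    using \<open>1 \<le> k\<close> by (cases k) auto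
  let ?v = "walk_sd \<rho> \<sigma>" and ?L = "- \<sigma> / (2 * \<rho>)"
  have v: "(\<lambda>t. ?v (Suc t + i)) \<longlonglongrightarrow> ?L" "(\<lambda>t. ?v t) \<longlonglongrightarrow> ?L" for i
    using LIMSEQ_ignore_initial_segment[OF walk_sd_tendsto[OF assms(2,1)], of "Suc i"] walk_sd_tendsto[OF assms(2,1)]
    by (simp_all del: walk_sd.simps)
  have "?L \<noteq> 0"
    using \<rho> \<open>0 < \<sigma>\<close> by simp
  have lim: "(\<lambda>t. \<rho> * \<sigma> / ?v (Suc t + j) * (\<Prod>i<j. 1 + \<rho> * \<sigma> / ?v (Suc t + i)) * (1 + \<rho> * ?v t / \<sigma>))
      \<longlonglongrightarrow> \<rho> * \<sigma> / ?L * (\<Prod>i<j. 1 + \<rho> * \<sigma> / ?L) * (1 + \<rho> * ?L / \<sigma>)"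
    using \<open>0 < \<sigma>\<close> by (intro tendsto_intros v \<open>?L \<noteq> 0\<close>) simp
  \<comment> \<open>at the limit \<open>\<rho>\<sigma>/L = -2\<rho>\<^sup>2\<close> and \<open>\<rho>L/\<sigma> = -1/2\<close>\<close>
  have "\<rho> * \<sigma> / ?L * (\<Prod>i<j. 1 + \<rho> * \<sigma> / ?L) * (1 + \<rho> * ?L / \<sigma>) = - \<rho>\<^sup>2 * (1 - 2 * \<rho>\<^sup>2) ^ (k - 1)"
    using \<rho> \<open>0 < \<sigma>\<close> by (simp add: k power2_eq_square mult.left_commute)
  with lim have lim': "(\<lambda>t. \<rho> * \<sigma> / ?v (Suc t + j) * (\<Prod>i<j. 1 + \<rho> * \<sigma> / ?v (Suc t + i)) * (1 + \<rho> * ?v t / \<sigma>))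
      \<longlonglongrightarrow> - \<rho>\<^sup>2 * (1 - 2 * \<rho>\<^sup>2) ^ (k - 1)"
    by (simp only:)
  have "(\<lambda>t. corr M (\<xi> (Suc t)) (\<xi> (Suc t + k))) \<longlonglongrightarrow> - \<rho>\<^sup>2 * (1 - 2 * \<rho>\<^sup>2) ^ (k - 1)"
  proof (rule Lim_transform_eventually[OF lim'])
    show "\<forall>\<^sub>F t in sequentially. \<rho> * \<sigma> / ?v (Suc t + j) * (\<Prod>i<j. 1 + \<rho> * \<sigma> / ?v (Suc t + i)) * (1 + \<rho> * ?v t / \<sigma>)
        = corr M (\<xi> (Suc t)) (\<xi> (Suc t + k))"
      unfolding k by (rule eventually_sequentiallyI[of 1]) (rule corr_innovations[OF \<rho>(1) \<open>0 < \<sigma>\<close>, symmetric])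
  qed
  then show ?thesis
    by (rule LIMSEQ_imp_Suc)
qed

end
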